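(* There are at least $16470$ pairwise inequivalent extremal Type II $\mathbb{Z}_4$-codes of length $40$, and there are at least $16470$ pairwise inequivalent extremal Type I $\mathbb{Z}_4$-codes of length $40$.
   Context: A $\mathbb{Z}_4$-code of length $n$ is a $\mathbb{Z}_4$-submodule $\mathcal{C}$ of $\mathbb{Z}_4^n$; it is self-dual if $\mathcal{C}=\mathcal{C}^\perp$ for the standard inner product. Two $\mathbb{Z}_4$-codes are equivalent if one is obtained from the other by permuting the coordinates and (if necessary) changing the signs of certain coordinates. The Euclidean weight of $x\in\mathbb{Z}_4^n$ is $n_1(x)+4n_2(x)+n_3(x)$, where $n_a(x)$ is the number of coordinates equal to $a$. A self-dual $\mathbb{Z}_4$-code is Type II if all its codewords have Euclidean weight divisible by $8$, and Type I otherwise. A self-dual $\mathbb{Z}_4$-code of length $n\not\equiv 23\pmod{24}$ has minimum Euclidean weight at most $8\lfloor n/24\rfloor+8$, and is extremal if it attains this bound; thus for length $40$, extremal means minimum Euclidean weight $16$. *)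

theory Defs
  imports "HOL-Analysis.Cartesian_Space" "HOL-Library.Numeral_Type"
begin

text \<open>
  The type \<open>4\<close> of \<open>HOL-Library.Numeral_Type\<close>, with its ring structure, is the ring of integers
  modulo 4, so \<open>4 ^ 'n\<close> is the free module of rank \<open>CARD('n)\<close> over it.
\<close>

text \<open>
  The constant \<open>module.subspace\<close> belongs to a locale, so it is meaningful only because scalar
  multiplication on \<open>4 ^ 'n\<close> satisfies the module axioms.
\<close>

lemma module_z4_vec: "module ((*s) :: 4 \<Rightarrow> 4 ^ 'n::finite \<Rightarrow> 4 ^ 'n)"
  by unfold_locales (simp_all add: vec_eq_iff algebra_simps)

definition z4_code :: "(4 ^ 'n::finite) set \<Rightarrow> bool" where
  "z4_code C \<longleftrightarrow> module.subspace ((*s) :: 4 \<Rightarrow> 4 ^ 'n \<Rightarrow> 4 ^ 'n) C"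

definition z4_inner :: "4 ^ 'n::finite \<Rightarrow> 4 ^ 'n \<Rightarrow> 4" where
  "z4_inner x y = (\<Sum>i\<in>UNIV. x $ i * y $ i)"

definition dual_code :: "(4 ^ 'n::finite) set \<Rightarrow> (4 ^ 'n) set" where
  "dual_code C = {x. \<forall>y\<in>C. z4_inner x y = 0}"

definition self_dual :: "(4 ^ 'n::finite) set \<Rightarrow> bool" where
  "self_dual C \<longleftrightarrow> z4_code C \<and> C = dual_code C"

definition code_equivalent :: "(4 ^ 'n::finite) set \<Rightarrow> (4 ^ 'n) set \<Rightarrow> bool" where
  "code_equivalent C D \<longleftrightarrow>
    (\<exists>(p :: 'n \<Rightarrow> 'n) (s :: 'n \<Rightarrow> 4). bij p \<and> (\<forall>i. s i \<in> {1, -1}) \<and>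
       D = (\<lambda>x. \<chi> i. s i * x $ p i) ` C)"

definition coord_count :: "4 \<Rightarrow> 4 ^ 'n::finite \<Rightarrow> nat" where
  "coord_count a x = card {i. x $ i = a}"

definition euclidean_weight :: "4 ^ 'n::finite \<Rightarrow> nat" where
  "euclidean_weight x = coord_count 1 x + 4 * coord_count 2 x + coord_count 3 x"

definition type_II :: "(4 ^ 'n::finite) set \<Rightarrow> bool" where
  "type_II C \<longleftrightarrow> self_dual C \<and> (\<forall>x\<in>C. 8 dvd euclidean_weight x)"

definition type_I :: "(4 ^ 'n::finite) set \<Rightarrow> bool" where
  "type_I C \<longleftrightarrow> self_dual C \<and> \<not> type_II C"

text \<open>
  The minimum is over the nonzero codewords. It is unspecified for the zero code, which is never
  self-dual, as every index type is nonempty.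
\<close>

definition min_euclidean_weight :: "(4 ^ 'n::finite) set \<Rightarrow> nat" where
  "min_euclidean_weight C = Min (euclidean_weight ` (C - {0}))"

text \<open>
  The bound \<open>8 * (n div 24) + 8\<close> on the minimum Euclidean weight applies to lengths
  not congruent to 23 modulo 24; extremality is only considered for those.
\<close>

definition extremal :: "(4 ^ 'n::finite) set \<Rightarrow> bool" where
  "extremal C \<longleftrightarrow> self_dual C \<and> CARD('n) mod 24 \<noteq> 23 \<and>
     min_euclidean_weight C = 8 * (CARD('n) div 24) + 8"

end

theory Submission
  imports Defs
begin

text \<open>
The proof counts: it produces a family of extremal codes that is too large to fall into fewer than
16470 equivalence classes.

The codes come from tournaments on 20 vertices. From a tournament \<open>n\<close> form the \<open>20 \<times> 20\<close> matrix \<open>N\<close>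
over the integers modulo 4 with off-diagonal entries \<open>\<plusminus>1\<close>, where \<open>-1\<close> in position \<open>(i, j)\<close> records
an arc from \<open>i\<close> to \<open>j\<close>, and with constant diagonal \<open>d \<in> {0, 2}\<close>. Modulo 4 such a matrix is
skew-symmetric, and if all scores (out-degrees) of \<open>n\<close> are even, then \<open>N\<^sup>2 = 1\<close>
(\<open>entry_square\<close>). Hence \<open>N N\<^sup>T = -1\<close>, and the words \<open>(z, z N)\<close> form a self-dual code
(\<open>code_self_dual\<close>). The rows of its generator matrix have Euclidean weight 24 if \<open>d = 2\<close> and 20 if
\<open>d = 0\<close>, so the code is of Type II in the first case and of Type I in the second.

The codewords of small Euclidean weight can be read off from the tournament. Modulo 2 all these codes
are generated by \<open>(1 | J - 1)\<close>, where \<open>J\<close> is the all-one matrix. If \<open>z\<close> has an odd number of odd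
coordinates, then \<open>(z, z N)\<close> has 20 odd coordinates. Otherwise let \<open>A\<close> be the set of odd coordinates
of \<open>z\<close>; then there are \<open>2 |A|\<close> odd coordinates, the weight is divisible by 8, and the coordinates
equal to 2 are controlled by the set of vertices outside \<open>A\<close> that receive an odd number of arcs from
\<open>A\<close> (\<open>euclidean_weight_word_even_ge\<close>). For nonzero words only \<open>|A| = 2\<close> and \<open>|A| = 4\<close> can lead to a weight below 16,
and this is excluded if that set and its complement in the outside of \<open>A\<close> are not too small; such
tournaments are called robust below (\<open>extremal_code\<close>).

There are at least \<open>2^170\<close> tournaments with even scores (\<open>card_even_tournaments\<close>), and a union bound
over the \<open>190 + 4845\<close> vertex sets of size 2 and 4 leaves at least a quarter of them robust
(\<open>card_robust\<close>). On the other hand a code of the family is equivalent to few others: an equivalence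
consists of 40 signs and a permutation, and a permutation that maps one code of the family to another
preserves the common residue code, so it is determined by its values on the 20 coordinates of an
information set. This leaves at most \<open>2^40 * 40^20\<close> codes (\<open>card_equivalent_le\<close>), and
\<open>2^168 > 16470 * 2^40 * 40^20\<close>.
\<close>

section \<open>Tournaments with even scores\<close>

definition tournament :: "('v \<Rightarrow> 'v \<Rightarrow> bool) \<Rightarrow> bool" where
  "tournament n \<longleftrightarrow> (\<forall>i j. n i j \<longleftrightarrow> i \<noteq> j \<and> \<not> n j i)"

text \<open>
Equal parity of all scores is what makes the rows of the matrix attached to a tournament orthogonal
modulo 4; see \<open>entry_square\<close>.
\<close>

definition even_tournaments :: "('v::finite \<Rightarrow> 'v \<Rightarrow> bool) set" where
  "even_tournaments = {n. tournament n \<and> (\<forall>i. even (card {j. n i j}))}"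

text \<open>
For a word \<open>(z, z N)\<close> whose left half is odd exactly on a set \<open>A\<close> of even size, this set determines, up to
complementation outside \<open>A\<close>, the places where a 2 is forced.
\<close>

definition profile :: "('v::finite \<Rightarrow> 'v \<Rightarrow> bool) \<Rightarrow> 'v set \<Rightarrow> 'v set" where
  "profile n A = {p. p \<notin> A \<and> odd (card {j \<in> A. n j p})}"

text \<open>
Reversing all arcs between two disjoint sets of even size keeps the parity of every score. These moves
relate tournaments with different profiles, which is how profiles are shown to be equidistributed.
\<close>

definition reverse_arcs :: "'v set \<Rightarrow> 'v set \<Rightarrow> ('v \<Rightarrow> 'v \<Rightarrow> bool) \<Rightarrow> 'v \<Rightarrow> 'v \<Rightarrow> bool" where
  "reverse_arcs A S n = (\<lambda>i j. n i j \<noteq> (i \<in> A \<and> j \<in> S \<or> i \<in> S \<and> j \<in> A))"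

lemma odd_card_Collect_neq:
  fixes P Q :: "'v::finite \<Rightarrow> bool"
  shows "odd (card {x. P x \<noteq> Q x}) \<longleftrightarrow> odd (card {x. P x}) \<noteq> odd (card {x. Q x})"
proof -
  have 1: "card {x. P x} = card {x. P x \<and> \<not> Q x} + card {x. P x \<and> Q x}"
    by (subst card_Un_disjoint[symmetric]) (auto intro: arg_cong[where f = card])
  have 2: "card {x. Q x} = card {x. Q x \<and> \<not> P x} + card {x. P x \<and> Q x}"
    by (subst card_Un_disjoint[symmetric]) (auto intro: arg_cong[where f = card])
  have 3: "card {x. P x \<noteq> Q x} = card {x. P x \<and> \<not> Q x} + card {x. Q x \<and> \<not> P x}"
    by (subst card_Un_disjoint[symmetric]) (auto intro: arg_cong[where f = card])
  show ?thesis unfolding 1 2 3 by auto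
qed

lemma reverse_arcs_twice: "reverse_arcs A S (reverse_arcs A S n) = n"
  unfolding reverse_arcs_def by auto

lemma reverse_arcs_even_tournaments:
  fixes n :: "'v::finite \<Rightarrow> 'v \<Rightarrow> bool"
  assumes n: "n \<in> even_tournaments" and AS: "A \<inter> S = {}" and "even (card A)" "even (card S)"
  shows "reverse_arcs A S n \<in> even_tournaments"
proof -
  have t: "tournament n" and e: "\<And>i. even (card {j. n i j})"
    using n by (auto simp: even_tournaments_def)
  have "tournament (reverse_arcs A S n)"
    using t AS unfolding tournament_def reverse_arcs_def by blast
  moreover have "even (card {j. reverse_arcs A S n i j})" for i
  proof -
    have "even (card {j. i \<in> A \<and> j \<in> S \<or> i \<in> S \<and> j \<in> A})"
      using assms(3,4) AS by (cases "i \<in> A"; cases "i \<in> S") auto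
    then show ?thesis
      using e[of i] odd_card_Collect_neq[of "n i" "\<lambda>j. i \<in> A \<and> j \<in> S \<or> i \<in> S \<and> j \<in> A"]
      unfolding reverse_arcs_def by simp
  qed
  ultimately show ?thesis by (simp add: even_tournaments_def)
qed

text \<open>
Exactly one of the two vertices \<open>i\<close>, \<open>q\<close> lies in \<open>A\<close>, so for \<open>p \<in> S\<close> exactly one arc between \<open>A\<close>
and \<open>p\<close> is reversed.
\<close>

lemma profile_reverse_arcs:
  assumes "i \<in> A" "q \<notin> A" "S \<inter> insert q A = {}" "p \<notin> insert q A"
  shows "p \<in> profile (reverse_arcs {i, q} S n) A \<longleftrightarrow> (p \<in> profile n A) \<noteq> (p \<in> S)"
proof -
  have *: "{j \<in> A. reverse_arcs {i, q} S n j p} = {j. (j \<in> A \<and> n j p) \<noteq> (j = i \<and> p \<in> S)}"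
    using assms unfolding reverse_arcs_def by auto
  show ?thesis
    using assms unfolding profile_def mem_Collect_eq * odd_card_Collect_neq
    by (cases "p \<in> S") auto
qed

lemma card_even_subsets:
  assumes "finite W" "w \<in> W"
  shows "card {S. S \<subseteq> W \<and> even (card S)} = 2 ^ (card W - 1)"
proof -
  have "bij_betw (\<lambda>S. S - {w}) {S. S \<subseteq> W \<and> even (card S)} (Pow (W - {w}))"
  proof (rule bij_betw_byWitness[where f' = "\<lambda>S. if even (card S) then S else insert w S"])
    show "\<forall>S\<in>{S. S \<subseteq> W \<and> even (card S)}.
        (if even (card (S - {w})) then S - {w} else insert w (S - {w})) = S"
    proof
      fix S assume S: "S \<in> {S. S \<subseteq> W \<and> even (card S)}"
      then have "finite S" using assms(1) finite_subset by auto
      then have "w \<in> S \<Longrightarrow> card S = Suc (card (S - {w}))"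
        by (rule card.remove)
      then show "(if even (card (S - {w})) then S - {w} else insert w (S - {w})) = S"
        using S by (cases "w \<in> S") auto
    qed
    show "(\<lambda>S. if even (card S) then S else insert w S) ` Pow (W - {w})
        \<subseteq> {S. S \<subseteq> W \<and> even (card S)}"
    proof clarify
      fix S assume S: "S \<subseteq> W - {w}"
      then have "finite S" "w \<notin> S" using assms(1) finite_subset by auto
      then show "(if even (card S) then S else insert w S) \<subseteq> W \<and>
          even (card (if even (card S) then S else insert w S))"
        using S assms(2) by auto
    qed
  qed (auto split: if_splits)
  from bij_betw_same_card[OF this] show ?thesis
    using assms by (simp add: card_Pow)
qed

text \<open>
Every value of the profile on \<open>W\<close> is taken by at most a fraction \<open>2 / 2 ^ card W\<close> of the tournaments
with even scores. Indeed, reversing the arcs between \<open>{i, q}\<close> and an even set \<open>S \<subseteq> W\<close> adds \<open>S\<close> to the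
profile, so from tournaments with the prescribed profile one obtains distinct tournaments for
distinct choices of \<open>S\<close>. The vertex \<open>q\<close> is sacrificed because the set \<open>{i, q}\<close> has to have even size.
\<close>

lemma card_profile_le:
  fixes A :: "'v::finite set" and W :: "'v set"
  assumes i: "i \<in> A" and q: "q \<notin> A" and W: "W = - insert q A" "W \<noteq> {}"
  shows "card {n \<in> even_tournaments. profile n A \<inter> W = P} * 2 ^ (card W - 1)
    \<le> card (even_tournaments :: ('v \<Rightarrow> 'v \<Rightarrow> bool) set)"
proof -
  let ?B = "{n \<in> even_tournaments. profile n A \<inter> W = P}"
  let ?E = "{S. S \<subseteq> W \<and> even (card S)}"
  let ?f = "\<lambda>(n, S). reverse_arcs {i, q} S n"
  have S_eq: "S = {p \<in> W. (p \<in> profile (reverse_arcs {i, q} S n) A) \<noteq> (p \<in> P)}"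
    if "n \<in> ?B" "S \<in> ?E" for n :: "'v \<Rightarrow> 'v \<Rightarrow> bool" and S :: "'v set"
  proof -
    have "S \<inter> insert q A = {}" using that W by auto
    then have "p \<in> S \<longleftrightarrow> (p \<in> profile (reverse_arcs {i, q} S n) A) \<noteq> (p \<in> P)" if "p \<in> W" for p
      using profile_reverse_arcs[OF i q, of S p n] that W \<open>n \<in> ?B\<close> by auto
    then show ?thesis using that by auto
  qed
  have "inj_on ?f (?B \<times> ?E)"
  proof (rule inj_onI, clarify)
    fix n S n' S'
    assume h: "n \<in> even_tournaments" "S \<subseteq> W" "even (card S)" "P = profile n A \<inter> W"
      "n' \<in> even_tournaments" "S' \<subseteq> W" "even (card S')" "profile n' A \<inter> W = profile n A \<inter> W"
      "reverse_arcs {i, q} S n = reverse_arcs {i, q} S' n'"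
    have "S = S'" using S_eq[of n S] S_eq[of n' S'] h by simp
    moreover have "n = n'" using h \<open>S = S'\<close> by (metis reverse_arcs_twice)
    ultimately show "n = n' \<and> S = S'" by simp
  qed
  moreover have "?f ` (?B \<times> ?E) \<subseteq> even_tournaments"
  proof clarify
    fix n :: "'v \<Rightarrow> 'v \<Rightarrow> bool" and S
    assume h: "n \<in> even_tournaments" "S \<subseteq> W" "even (card S)"
    have "i \<noteq> q" using i q by auto
    then show "reverse_arcs {i, q} S n \<in> even_tournaments"
      using h W i by (intro reverse_arcs_even_tournaments) auto
  qed
  ultimately have "card (?B \<times> ?E) \<le> card (even_tournaments :: ('v \<Rightarrow> 'v \<Rightarrow> bool) set)"
    by (intro card_inj_on_le) auto
  then show ?thesis
    using W(2) card_even_subsets[of W] by (auto simp: card_cartesian_product)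
qed

definition unbalanced :: "nat \<Rightarrow> ('v::finite \<Rightarrow> 'v \<Rightarrow> bool) \<Rightarrow> 'v set \<Rightarrow> bool" where
  "unbalanced k n A \<longleftrightarrow> card (profile n A) < k \<or> card (- A - profile n A) < k"

text \<open>
An unbalanced profile, restricted to \<open>W\<close>, has fewer than \<open>k\<close> elements or misses fewer than \<open>k\<close>. There
are at most twice as many such subsets of \<open>W\<close> as subsets with fewer than \<open>k\<close> elements.
\<close>

lemma card_unbalanced_le:
  fixes A :: "'v::finite set"
  assumes A: "A \<noteq> {}" and N: "card A + 2 \<le> CARD('v)"
  shows "card {n \<in> even_tournaments. unbalanced k n A} * 2 ^ (CARD('v) - card A - 2)
    \<le> 2 * (\<Sum>r<k. (CARD('v) - card A - 1) choose r) *
      card (even_tournaments :: ('v \<Rightarrow> 'v \<Rightarrow> bool) set)"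
proof -
  let ?T = "even_tournaments :: ('v \<Rightarrow> 'v \<Rightarrow> bool) set"
  obtain i where i: "i \<in> A" using A by auto
  have "A \<noteq> UNIV" using N by auto
  then obtain q where q: "q \<notin> A" by auto
  define W where "W = - insert q A"
  have cW: "card W = CARD('v) - card A - 1"
    using q unfolding W_def by (simp add: Compl_eq_Diff_UNIV card_Diff_subset)
  then have Wne: "W \<noteq> {}" using N by auto
  \<comment> \<open>the restrictions to \<open>W\<close> of unbalanced profiles are the small sets and their complements\<close>
  define Q where "Q = {P. P \<subseteq> W \<and> card P < k}"
  have cQ: "card Q = (\<Sum>r<k. card W choose r)"
  proof -
    have "Q = (\<Union>r<k. {P. P \<subseteq> W \<and> card P = r})" unfolding Q_def by auto
    also have "card \<dots> = (\<Sum>r<k. card {P. P \<subseteq> W \<and> card P = r})"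
      by (intro card_UN_disjoint) auto
    finally show ?thesis by (simp add: n_subsets)
  qed
  define R where "R = Q \<union> (\<lambda>P. W - P) ` Q"
  have cR: "card R \<le> 2 * card Q"
  proof -
    have "card R \<le> card Q + card ((\<lambda>P. W - P) ` Q)" unfolding R_def by (rule card_Un_le)
    also have "card ((\<lambda>P. W - P) ` Q) \<le> card Q" by (intro card_image_le) auto
    finally show ?thesis by simp
  qed
  have sub: "{n \<in> ?T. unbalanced k n A} \<subseteq> (\<Union>P\<in>R. {n \<in> ?T. profile n A \<inter> W = P})"
  proof clarify
    fix n assume n: "n \<in> ?T" "unbalanced k n A"
    have "profile n A \<inter> W \<in> R"
    proof (cases "card (profile n A) < k")
      case True
      then have "card (profile n A \<inter> W) < k"
        by (meson Int_lower1 card_mono finite order_le_less_trans)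
      then show ?thesis unfolding R_def Q_def by auto
    next
      case False
      then have "card (- A - profile n A) < k" using n by (auto simp: unbalanced_def)
      moreover have "card (W - profile n A) \<le> card (- A - profile n A)"
        by (intro card_mono) (auto simp: W_def)
      ultimately have "W - profile n A \<in> Q" unfolding Q_def by auto
      moreover have "profile n A \<inter> W = W - (W - profile n A)" by auto
      ultimately show ?thesis unfolding R_def by blast
    qed
    then show "n \<in> (\<Union>P\<in>R. {n \<in> ?T. profile n A \<inter> W = P})" using n by auto
  qed
  have "card {n \<in> ?T. unbalanced k n A} * 2 ^ (card W - 1)
      \<le> (\<Sum>P\<in>R. card {n \<in> ?T. profile n A \<inter> W = P}) * 2 ^ (card W - 1)"
    using card_mono[OF _ sub] card_UN_le[of R "\<lambda>P. {n \<in> ?T. profile n A \<inter> W = P}"]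
    by (auto intro!: mult_le_mono1 intro: le_trans)
  also have "\<dots> \<le> (\<Sum>P\<in>R. card ?T)"
    unfolding sum_distrib_right
    by (intro sum_mono card_profile_le[OF i q W_def Wne])
  also have "\<dots> \<le> 2 * card Q * card ?T"
    using cR by simp
  finally show ?thesis
    unfolding cQ cW by (simp add: numeral_2_eq_2)
qed

text \<open>
If the set \<open>A\<close> of odd coordinates of \<open>z\<close> has even size, the Euclidean weight of \<open>(z, z N)\<close> is at least
\<open>2 |A| + 4 m\<close>, where \<open>m\<close> is the smaller of the sizes of the profile and of its complement outside \<open>A\<close>.
It is also divisible by 8, so a lower bound of 12 gives 16: this needs \<open>m \<ge> 2\<close> for \<open>|A| = 2\<close> and
\<open>m \<ge> 1\<close> for \<open>|A| = 4\<close>.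
\<close>

definition robust :: "('v::finite \<Rightarrow> 'v \<Rightarrow> bool) \<Rightarrow> bool" where
  "robust n \<longleftrightarrow> (\<forall>A. (card A = 2 \<longrightarrow> \<not> unbalanced 2 n A) \<and> (card A = 4 \<longrightarrow> \<not> unbalanced 1 n A))"

lemma binomial_20_4: "(20 :: nat) choose 4 = 4845"
proof -
  have "fact 4 * fact 16 * ((20 :: nat) choose 4) = fact 20"
    using binomial_fact_lemma[of 4 20] by simp
  then show ?thesis by (simp add: fact_numeral)
qed

lemma card_20: "CARD(20) = 20"
  by simp

text \<open>
The union bound: the proportion of tournaments violating robustness is at most
\<open>190 * 36 / 2^16 + 4845 * 2 / 2^14 < 3 / 4\<close>.
\<close>

lemma card_robust:
  "card (even_tournaments :: (20 \<Rightarrow> 20 \<Rightarrow> bool) set)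
    \<le> 4 * card {n \<in> (even_tournaments :: (20 \<Rightarrow> 20 \<Rightarrow> bool) set). robust n}"
proof -
  let ?T = "even_tournaments :: (20 \<Rightarrow> 20 \<Rightarrow> bool) set"
  let ?U = "\<lambda>k A. {n \<in> ?T. unbalanced k n A}"
  let ?S = "\<lambda>r. {A :: 20 set. card A = r}"
  have c2: "card (?S 2) = 190" and c4: "card (?S 4) = 4845"
    using n_subsets[of "UNIV :: 20 set"] binomial_20_4 by (simp_all add: choose_two)
  have u2: "card (?U 2 A) * 65536 \<le> 36 * card ?T" if "A \<in> ?S 2" for A
  proof -
    have A: "A \<noteq> {}" "card A = 2" using that by auto
    have "(\<Sum>r<2. (20 - 2 - 1 :: nat) choose r) = 18" by (simp add: numeral_2_eq_2)
    then show ?thesis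
      using card_unbalanced_le[OF A(1), of 2, unfolded A(2)]
      by (simp only: card_20) simp
  qed
  have u4: "card (?U 1 A) * 16384 \<le> 2 * card ?T" if "A \<in> ?S 4" for A
  proof -
    have A: "A \<noteq> {}" "card A = 4" using that by auto
    have "(\<Sum>r<1. (20 - 4 - 1 :: nat) choose r) = 1" by simp
    then show ?thesis
      using card_unbalanced_le[OF A(1), of 1, unfolded A(2)]
      by (simp only: card_20) simp
  qed
  have "?T \<subseteq> {n \<in> ?T. robust n} \<union> ((\<Union>A\<in>?S 2. ?U 2 A) \<union> (\<Union>A\<in>?S 4. ?U 1 A))"
    unfolding robust_def by auto
  then have "card ?T \<le> card ({n \<in> ?T. robust n} \<union> ((\<Union>A\<in>?S 2. ?U 2 A) \<union> (\<Union>A\<in>?S 4. ?U 1 A)))"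
    by (intro card_mono) auto
  also have "\<dots> \<le> card {n \<in> ?T. robust n} + ((\<Sum>A\<in>?S 2. card (?U 2 A)) + (\<Sum>A\<in>?S 4. card (?U 1 A)))"
    by (intro order_trans[OF card_Un_le] add_mono order_refl card_UN_le) auto
  finally have "card ?T \<le> card {n \<in> ?T. robust n} +
      ((\<Sum>A\<in>?S 2. card (?U 2 A)) + (\<Sum>A\<in>?S 4. card (?U 1 A)))" .
  moreover have "(\<Sum>A\<in>?S 2. card (?U 2 A)) * 65536 \<le> 190 * (36 * card ?T)"
    using sum_mono[of "?S 2" "\<lambda>A. card (?U 2 A) * 65536", OF u2] by (simp add: sum_distrib_right c2)
  moreover have "(\<Sum>A\<in>?S 4. card (?U 1 A)) * 16384 \<le> 4845 * (2 * card ?T)"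
    using sum_mono[of "?S 4" "\<lambda>A. card (?U 1 A) * 16384", OF u4] by (simp add: sum_distrib_right c4)
  ultimately show ?thesis by linarith
qed

lemma card_arcs:
  assumes "tournament (n :: 20 \<Rightarrow> 20 \<Rightarrow> bool)"
  shows "card {(i, j). n i j} = 190"
proof -
  let ?L = "{(i, j). n i j}"
  have irrefl: "\<not> n i i" and asym: "n i j \<Longrightarrow> \<not> n j i"
    and total: "i \<noteq> j \<Longrightarrow> \<not> n i j \<Longrightarrow> n j i" for i j
    using assms unfolding tournament_def by metis+
  have c1: "card ((\<lambda>(i, j). (j, i)) ` ?L) = card ?L"
    by (intro card_image) (auto simp: inj_on_def)
  have "(UNIV :: (20 \<times> 20) set) = (?L \<union> (\<lambda>(i, j). (j, i)) ` ?L) \<union> range (\<lambda>i. (i, i))"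
    using total by fast
  then have "card (UNIV :: (20 \<times> 20) set)
      = card ((?L \<union> (\<lambda>(i, j). (j, i)) ` ?L) \<union> range (\<lambda>i. (i, i)))"
    by simp
  also have "\<dots> = card (?L \<union> (\<lambda>(i, j). (j, i)) ` ?L) + card (range (\<lambda>i :: 20. (i, i)))"
    using irrefl asym by (intro card_Un_disjoint) auto
  also have "card (?L \<union> (\<lambda>(i, j). (j, i)) ` ?L) = card ?L + card ((\<lambda>(i, j). (j, i)) ` ?L)"
    using irrefl asym by (intro card_Un_disjoint) auto
  also have "card (range (\<lambda>i :: 20. (i, i))) = 20"
    by (subst card_image) (auto simp: inj_on_def)
  finally show ?thesis using c1 by (simp add: card_cartesian_product flip: UNIV_Times_UNIV)
qed

lemma card_tournaments: "2 ^ 190 \<le> card {n :: 20 \<Rightarrow> 20 \<Rightarrow> bool. tournament n}"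
proof -
  let ?L = "{(i, j). (i :: 20) < j}"
  let ?f = "\<lambda>E i j. if i < j then (i, j) \<in> E else i \<noteq> j \<and> (j, i) \<notin> E"
  have "tournament (\<lambda>i j. (i :: 20) < j)"
    unfolding tournament_def by auto
  then have "card ?L = 190" by (rule card_arcs)
  then have "card (Pow ?L) = 2 ^ 190" by (simp only: card_Pow finite)
  moreover have "card (Pow ?L) \<le> card {n :: 20 \<Rightarrow> 20 \<Rightarrow> bool. tournament n}"
  proof (rule card_inj_on_le)
    show "inj_on ?f (Pow ?L)"
    proof (rule inj_onI)
      fix E F assume h: "E \<in> Pow ?L" "F \<in> Pow ?L" "?f E = ?f F"
      have "(i, j) \<in> E \<longleftrightarrow> (i, j) \<in> F" if "i < j" for i j
        using fun_cong[OF fun_cong[OF h(3), of i], of j] that by simp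
      then show "E = F" using h(1,2) by fast
    qed
    show "?f ` Pow ?L \<subseteq> {n. tournament n}"
    proof (rule image_subsetI)
      fix E :: "(20 \<times> 20) set"
      show "?f E \<in> {n. tournament n}"
        unfolding tournament_def mem_Collect_eq by (metis less_asym neq_iff)
    qed
  qed simp
  ultimately show ?thesis by simp
qed

text \<open>
The parities of all scores but that of \<open>v\<close> can be corrected by choosing the arcs at \<open>v\<close> suitably.
The score of \<open>v\<close> is then even as well, since the sum of all scores is the number of arcs, which is 190.
\<close>

definition fix_star :: "'v \<Rightarrow> ('v::finite \<Rightarrow> 'v \<Rightarrow> bool) \<Rightarrow> 'v \<Rightarrow> 'v \<Rightarrow> bool" where
  "fix_star v n i j =
    (if i \<noteq> v \<and> j = v then odd (card {k. k \<noteq> v \<and> n i k})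
     else if i = v \<and> j \<noteq> v then even (card {k. k \<noteq> v \<and> n j k}) else n i j)"

lemma fix_star_even_tournaments:
  assumes n: "tournament (n :: 20 \<Rightarrow> 20 \<Rightarrow> bool)"
  shows "fix_star v n \<in> even_tournaments"
proof -
  let ?m = "fix_star v n"
  have t: "tournament ?m"
    unfolding tournament_def
  proof (intro allI)
    fix i j
    have "n i j \<longleftrightarrow> i \<noteq> j \<and> \<not> n j i"
      using n unfolding tournament_def by metis
    then show "?m i j \<longleftrightarrow> i \<noteq> j \<and> \<not> ?m j i"
      unfolding fix_star_def by (cases "i = v"; cases "j = v") auto
  qed
  have e: "even (card {j. ?m i j})" if "i \<noteq> v" for i
  proof -
    let ?X = "{k. k \<noteq> v \<and> n i k}"
    have "{j. ?m i j} = (if odd (card ?X) then insert v ?X else ?X)"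
      using that unfolding fix_star_def by auto
    then show ?thesis by simp
  qed
  have "(\<Sum>i\<in>UNIV. card {j. ?m i j}) = card (SIGMA i:UNIV. {j. ?m i j})"
    by (rule card_SigmaI[symmetric]) auto
  also have "(SIGMA i:UNIV. {j. ?m i j}) = {(i, j). ?m i j}" by auto
  finally have "even (\<Sum>i\<in>UNIV. card {j. ?m i j})" by (simp only: card_arcs[OF t]) simp
  moreover have "(\<Sum>i\<in>UNIV. card {j. ?m i j}) = card {j. ?m v j} + (\<Sum>i\<in>UNIV - {v}. card {j. ?m i j})"
    by (rule sum.remove) auto
  moreover have "even (\<Sum>i\<in>UNIV - {v}. card {j. ?m i j})"
    by (intro dvd_sum e) auto
  ultimately have "even (card {j. ?m v j})" by simp
  then have "even (card {j. ?m i j})" for i by (cases "i = v") (simp_all only: e not_False_eq_True)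
  then show ?thesis using t unfolding even_tournaments_def by simp
qed

text \<open>
A tournament can be recovered from its corrected version together with the original arcs into the
special vertex, so the correction is at most \<open>2^20\<close> to one.
\<close>

lemma card_even_tournaments:
  "2 ^ 170 \<le> card (even_tournaments :: (20 \<Rightarrow> 20 \<Rightarrow> bool) set)"
proof -
  let ?A = "{n :: 20 \<Rightarrow> 20 \<Rightarrow> bool. tournament n}"
  let ?T = "even_tournaments :: (20 \<Rightarrow> 20 \<Rightarrow> bool) set"
  let ?f = "\<lambda>n. (fix_star 0 n, {i. n i 0})"
  have "inj_on ?f ?A"
  proof (rule inj_onI)
    fix n m :: "20 \<Rightarrow> 20 \<Rightarrow> bool"
    assume h: "n \<in> ?A" "m \<in> ?A" "?f n = ?f m"
    have "n i j = m i j" for i j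
    proof -
      have z: "n i 0 = m i 0" for i using h(3) by auto
      show ?thesis
      proof (cases "i = 0 \<or> j = 0")
        case True
        have tn: "n i j = (i \<noteq> j \<and> \<not> n j i)" and tm: "m i j = (i \<noteq> j \<and> \<not> m j i)"
          using h(1,2) unfolding tournament_def by blast+
        show ?thesis
        proof (cases "j = 0")
          case False
          then have "i = 0" using True by simp
          then show ?thesis using z tn tm by simp
        qed (simp add: z)
      next
        case False
        then have "n i j = fix_star 0 n i j" "m i j = fix_star 0 m i j"
          unfolding fix_star_def by auto
        then show ?thesis using h(3) by simp
      qed
    qed
    then show "n = m" by (intro ext)
  qed
  moreover have "?f ` ?A \<subseteq> ?T \<times> UNIV"
    using fix_star_even_tournaments by auto
  ultimately have "card ?A \<le> card (?T \<times> (UNIV :: 20 set set))"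
    by (intro card_inj_on_le) auto
  then have "card ?A \<le> card ?T * 2 ^ 20"
    by (simp add: card_cartesian_product card_Pow flip: Pow_UNIV)
  then have "2 ^ 190 \<le> card ?T * 2 ^ 20" using card_tournaments by (rule order_trans[rotated])
  then show ?thesis by simp
qed

section \<open>Weights over the integers modulo 4\<close>

definition odd4 :: "4 \<Rightarrow> bool" where
  "odd4 a \<longleftrightarrow> a = 1 \<or> a = 3"

definition wt4 :: "4 \<Rightarrow> nat" where
  "wt4 a = (if a = 0 then 0 else if a = 2 then 4 else 1)"

lemma z4_cases: "a = 0 \<or> a = 1 \<or> a = 2 \<or> a = (3 :: 4)"
  using exhaust_4[of a] by auto

lemma odd4_add: "odd4 (a + b) \<longleftrightarrow> odd4 a \<noteq> odd4 b"
  using z4_cases[of a] z4_cases[of b] by (auto simp: odd4_def)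

lemma odd4_mult: "odd4 (a * b) \<longleftrightarrow> odd4 a \<and> odd4 b"
  using z4_cases[of a] z4_cases[of b] by (auto simp: odd4_def)

lemma odd4_sum:
  fixes f :: "'v::finite \<Rightarrow> 4"
  shows "odd4 (\<Sum>j\<in>UNIV. f j) \<longleftrightarrow> odd (card {j. odd4 (f j)})"
proof -
  have "odd4 (\<Sum>j\<in>F. f j) \<longleftrightarrow> odd (card {j \<in> F. odd4 (f j)})" if "finite F" for F
    using that
  proof (induction F)
    case empty
    then show ?case by (simp add: odd4_def)
  next
    case (insert x F)
    then have "{j \<in> insert x F. odd4 (f j)} =
        (if odd4 (f x) then insert x {j \<in> F. odd4 (f j)} else {j \<in> F. odd4 (f j)})"
      by auto
    then show ?case using insert by (simp add: odd4_add)
  qed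
  from this[OF finite] show ?thesis by simp
qed

lemma of_nat_z4_eq_0: "(of_nat k :: 4) = 0 \<longleftrightarrow> 4 dvd k"
proof -
  have "(of_nat k :: 4) = of_nat (k mod 4 + 4 * (k div 4))" by simp
  also have "\<dots> = of_nat (k mod 4) + 4 * of_nat (k div 4)"
    by (simp only: of_nat_add of_nat_mult of_nat_numeral)
  also have "(4 :: 4) = 0" by simp
  also have "of_nat (k mod 4) + 0 * of_nat (k div 4) = (of_nat (k mod 4) :: 4)" by simp
  finally have *: "(of_nat k :: 4) = of_nat (k mod 4)" .
  have "k mod 4 \<in> {0, 1, 2, 3}" by auto
  then show ?thesis unfolding * by (auto simp: dvd_eq_mod_eq_0)
qed

lemma of_nat_double: "(of_nat (2 * k) :: 4) = (if odd k then 2 else 0)"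
proof (cases "even k")
  case True
  then obtain l where "k = 2 * l" by auto
  then have "4 dvd 2 * k" by auto
  then have "(of_nat (2 * k) :: 4) = 0" unfolding of_nat_z4_eq_0 .
  then show ?thesis using True by simp
next
  case False
  then obtain l where "k = 2 * l + 1" by (elim oddE)
  then have "(of_nat (2 * k) :: 4) = of_nat (4 * l) + 2" by simp
  moreover have "(of_nat (4 * l) :: 4) = 0" unfolding of_nat_z4_eq_0 by simp
  ultimately show ?thesis using False by simp
qed

lemma euclidean_weight_eq_sum: "euclidean_weight x = (\<Sum>i\<in>UNIV. wt4 (x $ i))"
proof -
  have *: "coord_count a x = (\<Sum>i\<in>UNIV. of_bool (x $ i = a))" for a
    by (simp add: coord_count_def of_bool_def sum.If_cases)
  have "euclidean_weight x =
      (\<Sum>i\<in>UNIV. of_bool (x $ i = 1) + 4 * of_bool (x $ i = 2) + of_bool (x $ i = 3))"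
    unfolding euclidean_weight_def * by (simp only: sum.distrib sum_distrib_left)
  also have "\<dots> = (\<Sum>i\<in>UNIV. wt4 (x $ i))"
  proof (rule sum.cong)
    fix i
    show "of_bool (x $ i = 1) + 4 * of_bool (x $ i = 2) + of_bool (x $ i = 3) = wt4 (x $ i)"
      using z4_cases[of "x $ i"] by (auto simp: wt4_def)
  qed simp
  finally show ?thesis .
qed

text \<open>
Integer representatives: the Euclidean weight modulo 8 is the sum of the squares of the coordinates
and refines the inner product modulo 4, which is expressed by \<open>wt4_add\<close>.
\<close>

definition lift4 :: "4 \<Rightarrow> nat" where
  "lift4 a = (if a = 0 then 0 else if a = 1 then 1 else if a = 2 then 2 else 3)"

lemma of_nat_lift4: "of_nat (lift4 a) = a"
  using z4_cases[of a] by (auto simp: lift4_def)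

lemma wt4_add: "wt4 (a + b) mod 8 = (wt4 a + wt4 b + 2 * lift4 (a * b)) mod 8"
  using z4_cases[of a] z4_cases[of b] by (elim disjE) (simp_all add: wt4_def lift4_def)

text \<open>
The polarisation of the Euclidean weight is twice the inner product, which vanishes modulo 8 if the
inner product vanishes modulo 4.
\<close>

lemma euclidean_weight_add:
  assumes "z4_inner x y = 0"
  shows "euclidean_weight (x + y) mod 8 = (euclidean_weight x + euclidean_weight y) mod 8"
proof -
  have "(of_nat (\<Sum>i\<in>UNIV. lift4 (x $ i * y $ i)) :: 4) = 0"
    using assms by (simp add: z4_inner_def of_nat_lift4)
  then have "4 dvd (\<Sum>i\<in>UNIV. lift4 (x $ i * y $ i))" unfolding of_nat_z4_eq_0 .
  then have d: "8 dvd 2 * (\<Sum>i\<in>UNIV. lift4 (x $ i * y $ i))" by auto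
  have "euclidean_weight (x + y) mod 8 = (\<Sum>i\<in>UNIV. wt4 (x $ i + y $ i) mod 8) mod 8"
    by (simp add: euclidean_weight_eq_sum mod_sum_eq)
  also have "\<dots> = (\<Sum>i\<in>UNIV. wt4 (x $ i) + wt4 (y $ i) + 2 * lift4 (x $ i * y $ i)) mod 8"
    by (simp only: wt4_add mod_sum_eq)
  also have "\<dots> = (euclidean_weight x + euclidean_weight y
      + 2 * (\<Sum>i\<in>UNIV. lift4 (x $ i * y $ i))) mod 8"
    by (simp only: euclidean_weight_eq_sum sum.distrib sum_distrib_left)
  also have "\<dots> = (euclidean_weight x + euclidean_weight y) mod 8"
    using d by (metis add.right_neutral dvd_eq_mod_eq_0 mod_add_right_eq)
  finally show ?thesis .
qed

section \<open>The self-dual code of a tournament\<close>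

text \<open>
Any identification of the 40 coordinates with two copies of the 20 vertices will do; the left copy is
an information set for all the codes considered.
\<close>

definition half :: "20 + 20 \<Rightarrow> 40" where
  "half = (SOME h. bij h)"

definition lft :: "20 \<Rightarrow> 40" where
  "lft i = half (Inl i)"

definition rgt :: "20 \<Rightarrow> 40" where
  "rgt i = half (Inr i)"

lemma bij_half: "bij half"
proof -
  have "card (UNIV :: (20 + 20) set) = card (UNIV :: 40 set)" by simp
  then have "\<exists>h :: 20 + 20 \<Rightarrow> 40. bij h"
    by (intro finite_same_card_bij) auto
  then show ?thesis unfolding half_def by (rule someI_ex)
qed

lemma halves_cases: obtains i where "k = lft i" | i where "k = rgt i"
proof -
  obtain s where "k = half s" using bij_is_surj[OF bij_half] by (metis surjD)
  then show ?thesis using that unfolding lft_def rgt_def by (cases s) auto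
qed

lemma sum_halves: "(\<Sum>k\<in>UNIV. f k) = (\<Sum>i\<in>UNIV. f (lft i)) + (\<Sum>i\<in>UNIV. f (rgt i))"
proof -
  have "(\<Sum>k\<in>UNIV. f k) = (\<Sum>s\<in>UNIV. f (half s))"
    using sum.reindex_bij_betw[OF bij_half] by metis
  also have "\<dots> = (\<Sum>i\<in>UNIV. f (lft i)) + (\<Sum>i\<in>UNIV. f (rgt i))"
    unfolding lft_def rgt_def UNIV_sum by (subst sum.union_disjoint) (auto simp: sum.reindex)
  finally show ?thesis .
qed

definition entry :: "4 \<Rightarrow> (20 \<Rightarrow> 20 \<Rightarrow> bool) \<Rightarrow> 20 \<Rightarrow> 20 \<Rightarrow> 4" where
  "entry d n i j = (if i = j then d else if n i j then - 1 else 1)"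

definition code :: "4 \<Rightarrow> (20 \<Rightarrow> 20 \<Rightarrow> bool) \<Rightarrow> (4 ^ 40) set" where
  "code d n = {x. \<forall>i. x $ rgt i = (\<Sum>j\<in>UNIV. x $ lft j * entry d n j i)}"

definition word :: "4 \<Rightarrow> (20 \<Rightarrow> 20 \<Rightarrow> bool) \<Rightarrow> (20 \<Rightarrow> 4) \<Rightarrow> 4 ^ 40" where
  "word d n z = (\<chi> k. case inv half k of Inl i \<Rightarrow> z i | Inr i \<Rightarrow> \<Sum>j\<in>UNIV. z j * entry d n j i)"

lemma word_lft [simp]: "word d n z $ lft i = z i"
  by (simp add: word_def lft_def inv_f_f[OF bij_is_inj[OF bij_half]])

lemma word_rgt [simp]: "word d n z $ rgt i = (\<Sum>j\<in>UNIV. z j * entry d n j i)"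
  by (simp add: word_def rgt_def inv_f_f[OF bij_is_inj[OF bij_half]])

definition unit :: "20 \<Rightarrow> 4 \<Rightarrow> 20 \<Rightarrow> 4" where
  "unit j a = (\<lambda>k. if k = j then a else 0)"

lemma sum_unit: "(\<Sum>k\<in>UNIV. unit j a k * f k) = a * f j"
proof -
  have "(\<Sum>k\<in>UNIV. unit j a k * f k) = (\<Sum>k\<in>UNIV. if k = j then a * f j else 0)"
    by (intro sum.cong) (auto simp: unit_def)
  then show ?thesis by simp
qed

lemma vec_eq_halves: "x = y \<longleftrightarrow> (\<forall>i. x $ lft i = y $ lft i) \<and> (\<forall>i. x $ rgt i = y $ rgt i)"
  for x y :: "4 ^ 40"
  unfolding vec_eq_iff by (metis halves_cases)

lemma code_eq_range_word: "code d n = range (word d n)"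
proof -
  have "x = word d n (\<lambda>i. x $ lft i)" if "x \<in> code d n" for x
    using that by (simp add: vec_eq_halves code_def)
  moreover have "word d n z \<in> code d n" for z
    by (simp add: code_def)
  ultimately show ?thesis by auto
qed

lemma entry_skew:
  assumes "tournament n" "d \<in> {0, 2}"
  shows "entry d n j i = - entry d n i j"
proof -
  have "n i j \<longleftrightarrow> i \<noteq> j \<and> \<not> n j i" using assms(1) unfolding tournament_def by metis
  then show ?thesis using assms(2) by (auto simp: entry_def)
qed

text \<open>
For \<open>i \<noteq> j\<close> skew-symmetry turns the sum into minus the inner product of rows \<open>i\<close> and \<open>j\<close>. Up to the
terms with \<open>k = i\<close> or \<open>k = j\<close>, each column contributes \<open>-1\<close> or \<open>1\<close> according to whether the rows agree,
that is \<open>3 + 2 * [n i k \<noteq> n j k]\<close>. The columns \<open>i\<close> and \<open>j\<close> together contribute 0, which equals their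
share \<open>3 + 3 + 2\<close> in this formula, because exactly one of the two arcs between \<open>i\<close> and \<open>j\<close> is present.
The total is therefore twice the number of columns where the arcs differ, and this number is even
since the scores of \<open>i\<close> and \<open>j\<close> have the same parity.
\<close>

lemma entry_square:
  assumes n: "n \<in> even_tournaments" and d: "d \<in> {0, 2}"
  shows "(\<Sum>k\<in>UNIV. entry d n i k * entry d n k j) = (if i = j then 1 else 0)"
proof -
  have t: "tournament n" and e: "\<And>i. even (card {j. n i j})"
    using n by (auto simp: even_tournaments_def)
  have irrefl: "\<not> n i i" for i using t unfolding tournament_def by metis
  have skew: "entry d n k j = - entry d n j k" for k by (rule entry_skew[OF t d])
  show ?thesis
  proof (cases "i = j")
    case True
    have "(\<Sum>k\<in>UNIV. entry d n i k * entry d n k j) =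
        entry d n i i * entry d n i j + (\<Sum>k\<in>UNIV - {i}. entry d n i k * entry d n k j)"
      by (rule sum.remove) auto
    also have "(\<Sum>k\<in>UNIV - {i}. entry d n i k * entry d n k j) = (\<Sum>k\<in>UNIV - {i}. - 1)"
      unfolding skew using True by (intro sum.cong) (auto simp: entry_def)
    also have "entry d n i i * entry d n i j = 0"
      using d True by (auto simp: entry_def)
    finally show ?thesis using True by (simp add: card_Diff_subset)
  next
    case False
    let ?c = "\<lambda>k. entry d n i k * entry d n k j"
    let ?b = "\<lambda>k. 3 + 2 * of_bool (n i k \<noteq> n j k) :: 4"
    let ?R = "UNIV - {i} - {j}"
    have split: "(\<Sum>k\<in>UNIV. f k) = f i + f j + (\<Sum>k\<in>?R. f k)" for f :: "20 \<Rightarrow> 4"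
    proof -
      have "(\<Sum>k\<in>UNIV. f k) = f i + (\<Sum>k\<in>UNIV - {i}. f k)" by (rule sum.remove) auto
      also have "(\<Sum>k\<in>UNIV - {i}. f k) = f j + (\<Sum>k\<in>?R. f k)"
        using False by (intro sum.remove) auto
      finally show ?thesis by (simp only: add.assoc)
    qed
    \<comment> \<open>exactly one of the arcs from \<open>i\<close> to \<open>j\<close> and from \<open>j\<close> to \<open>i\<close> is present\<close>
    have "?c i + ?c j = ?b i + ?b j"
    proof -
      have "n i j \<longleftrightarrow> \<not> n j i" using t False unfolding tournament_def by metis
      then show ?thesis using d False by (auto simp: entry_def irrefl)
    qed
    moreover have "(\<Sum>k\<in>?R. ?c k) = (\<Sum>k\<in>?R. ?b k)"
      unfolding skew by (intro sum.cong) (auto simp: entry_def)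
    ultimately have "(\<Sum>k\<in>UNIV. ?c k) = (\<Sum>k\<in>UNIV. ?b k)"
      by (simp only: split[of ?c] split[of ?b])
    also have "\<dots> = of_nat (2 * card {k. n i k \<noteq> n j k})"
      by (simp add: sum.distrib of_bool_def sum.If_cases flip: sum_distrib_left)
    also have "\<dots> = 0"
      using e odd_card_Collect_neq[of "n i" "n j"] by (simp only: of_nat_double) simp
    finally show ?thesis using False by simp
  qed
qed


lemma z4_inner_halves:
  "z4_inner x y = (\<Sum>i\<in>UNIV. x $ lft i * y $ lft i) + (\<Sum>i\<in>UNIV. x $ rgt i * y $ rgt i)"
  unfolding z4_inner_def by (rule sum_halves)

text \<open>
The matrix form is \<open>z (1 + N N\<^sup>T) z'\<^sup>T = z (1 - N\<^sup>2) z'\<^sup>T = 0\<close>.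
\<close>

lemma z4_inner_word:
  assumes n: "n \<in> even_tournaments" and d: "d \<in> {0, 2}"
  shows "z4_inner (word d n z) (word d n z') = 0"
proof -
  have t: "tournament n" using n by (auto simp: even_tournaments_def)
  let ?N = "entry d n"
  have "(\<Sum>i\<in>UNIV. (\<Sum>j\<in>UNIV. z j * ?N j i) * (\<Sum>k\<in>UNIV. z' k * ?N k i))
      = (\<Sum>i\<in>UNIV. \<Sum>j\<in>UNIV. \<Sum>k\<in>UNIV. - (z j * z' k * (?N j i * ?N i k)))"
    unfolding sum_product
  proof (intro sum.cong refl)
    fix i j k
    show "z j * ?N j i * (z' k * ?N k i) = - (z j * z' k * (?N j i * ?N i k))"
      using entry_skew[OF t d, of i k] by (simp add: algebra_simps)
  qed
  also have "\<dots> = (\<Sum>j\<in>UNIV. \<Sum>k\<in>UNIV. \<Sum>i\<in>UNIV. - (z j * z' k * (?N j i * ?N i k)))"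
    by (subst sum.swap, rule sum.cong[OF refl], rule sum.swap)
  also have "\<dots> = (\<Sum>j\<in>UNIV. \<Sum>k\<in>UNIV. - (z j * z' k * (if j = k then 1 else 0)))"
    by (simp add: sum_negf entry_square[OF n d] flip: sum_distrib_left)
  also have "\<dots> = - (\<Sum>j\<in>UNIV. z j * z' j)"
    by (simp add: sum_negf if_distrib cong: if_cong)
  finally show ?thesis unfolding z4_inner_halves by simp
qed

text \<open>
If \<open>(x, y)\<close> is orthogonal to all rows of \<open>(1 | N)\<close>, then \<open>x = - y N\<^sup>T = y N\<close>, hence \<open>x N = y N\<^sup>2 = y\<close>.
\<close>

lemma code_self_dual:
  assumes n: "n \<in> even_tournaments" and d: "d \<in> {0, 2}"
  shows "self_dual (code d n)"
proof -
  have t: "tournament n" using n by (auto simp: even_tournaments_def)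
  let ?N = "entry d n"
  have "z4_code (code d n)"
    unfolding z4_code_def module.subspace_def[OF module_z4_vec] code_def
    by (auto simp: distrib_right sum.distrib sum_distrib_left mult.assoc)
  moreover have "code d n = dual_code (code d n)"
  proof
    show "code d n \<subseteq> dual_code (code d n)"
      unfolding dual_code_def code_eq_range_word by (auto simp: z4_inner_word[OF n d])
    show "dual_code (code d n) \<subseteq> code d n"
    proof
      fix x assume "x \<in> dual_code (code d n)"
      then have x: "z4_inner x (word d n z) = 0" for z
        by (auto simp: dual_code_def code_eq_range_word)
      have l: "x $ lft j = (\<Sum>i\<in>UNIV. x $ rgt i * ?N i j)" for j
      proof -
        have "z4_inner x (word d n (unit j 1)) =
            x $ lft j + (\<Sum>i\<in>UNIV. x $ rgt i * ?N j i)"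
          unfolding z4_inner_halves
          using sum_unit[of j 1 "\<lambda>k. x $ lft k"] by (simp add: sum_unit mult.commute)
        also have "(\<Sum>i\<in>UNIV. x $ rgt i * ?N j i) = - (\<Sum>i\<in>UNIV. x $ rgt i * ?N i j)"
          by (simp add: entry_skew[OF t d, of j] sum_negf)
        finally show ?thesis using x by simp
      qed
      have "x $ rgt k = (\<Sum>j\<in>UNIV. x $ lft j * ?N j k)" for k
      proof -
        have "(\<Sum>j\<in>UNIV. x $ lft j * ?N j k) = (\<Sum>j\<in>UNIV. \<Sum>i\<in>UNIV. x $ rgt i * (?N i j * ?N j k))"
          unfolding l by (simp add: sum_distrib_right mult.assoc)
        also have "\<dots> = (\<Sum>i\<in>UNIV. x $ rgt i * (\<Sum>j\<in>UNIV. ?N i j * ?N j k))"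
          by (subst sum.swap) (simp add: sum_distrib_left)
        also have "\<dots> = x $ rgt k"
          by (simp add: entry_square[OF n d] if_distrib cong: if_cong)
        finally show ?thesis by simp
      qed
      then show "x \<in> code d n" unfolding code_def by simp
    qed
  qed
  ultimately show ?thesis by (simp add: self_dual_def)
qed

section \<open>Euclidean weights of the codewords\<close>

lemma euclidean_weight_halves:
  "euclidean_weight x = (\<Sum>i\<in>UNIV. wt4 (x $ lft i) + wt4 (x $ rgt i))" for x :: "4 ^ 40"
  unfolding euclidean_weight_eq_sum sum_halves by (simp add: sum.distrib)

lemma word_add: "word d n (\<lambda>i. z i + z' i) = word d n z + word d n z'"
  by (simp add: vec_eq_halves distrib_right sum.distrib)

lemma euclidean_weight_word_unit:
  assumes d: "d \<in> {0, 2}"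
  shows "euclidean_weight (word d n (unit j a)) mod 8 =
    (if d = 0 \<and> odd4 a then 4 else 0)"
proof -
  have "(\<Sum>i\<in>UNIV. wt4 (unit j a i)) = wt4 a"
  proof -
    have "(\<Sum>i\<in>UNIV. wt4 (unit j a i)) = (\<Sum>i\<in>UNIV. if i = j then wt4 a else 0)"
      by (intro sum.cong) (auto simp: unit_def wt4_def)
    then show ?thesis by simp
  qed
  moreover have "(\<Sum>i\<in>UNIV. wt4 (a * entry d n j i)) = wt4 (a * d) + 19 * wt4 a"
  proof -
    have "(\<Sum>i\<in>UNIV. wt4 (a * entry d n j i)) =
        wt4 (a * entry d n j j) + (\<Sum>i\<in>UNIV - {j}. wt4 (a * entry d n j i))"
      by (rule sum.remove) auto
    also have "(\<Sum>i\<in>UNIV - {j}. wt4 (a * entry d n j i)) = (\<Sum>i\<in>UNIV - {j}. wt4 a)"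
      using z4_cases[of a] by (intro sum.cong) (auto simp: entry_def wt4_def)
    finally show ?thesis by (simp add: entry_def card_Diff_subset)
  qed
  ultimately have "euclidean_weight (word d n (unit j a)) = wt4 (a * d) + 20 * wt4 a"
    unfolding euclidean_weight_halves by (simp add: sum.distrib sum_unit)
  then show ?thesis
    using d z4_cases[of a] by (auto simp: wt4_def odd4_def)
qed

text \<open>
The Euclidean weight is additive modulo 8 on a self-orthogonal code, so it is determined by its values
on multiples of the rows of the generator matrix: 24 for \<open>d = 2\<close> and 20 for \<open>d = 0\<close> on the odd multiples.
\<close>

lemma euclidean_weight_word_mod_8:
  assumes n: "n \<in> even_tournaments" and d: "d \<in> {0, 2}"
  shows "euclidean_weight (word d n z) mod 8 =
    (if d = 0 \<and> odd (card {i. odd4 (z i)}) then 4 else 0)"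
proof -
  \<comment> \<open>the coordinates of \<open>z\<close> are added one at a time\<close>
  define r where "r F = (\<lambda>i. if i \<in> F then z i else 0)" for F
  have "euclidean_weight (word d n (r F)) mod 8 =
      (if d = 0 \<and> odd (card {i. odd4 (r F i)}) then 4 else 0)" if "finite F" for F
    using that
  proof (induction F)
    case empty
    have "r {} = unit 0 0" by (simp add: r_def unit_def fun_eq_iff)
    then show ?case
      using euclidean_weight_word_unit[OF d, of n 0 0] by (simp add: unit_def odd4_def)
  next
    case (insert j F)
    have eq: "r (insert j F) = (\<lambda>i. r F i + unit j (z j) i)"
      using insert(2) by (auto simp: r_def unit_def fun_eq_iff)
    have "euclidean_weight (word d n (r (insert j F))) mod 8
        = (euclidean_weight (word d n (r F)) + euclidean_weight (word d n (unit j (z j)))) mod 8"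
      unfolding eq word_add by (intro euclidean_weight_add z4_inner_word n d)
    also have "\<dots> = (euclidean_weight (word d n (r F)) mod 8
        + euclidean_weight (word d n (unit j (z j))) mod 8) mod 8"
      by (simp add: mod_add_eq)
    also have "\<dots> = (if d = 0 \<and> odd (card {i. odd4 (r (insert j F) i)}) then 4 else 0)"
    proof -
      have "{i. odd4 (unit j (z j) i)} = (if odd4 (z j) then {j} else {})"
        by (auto simp: unit_def odd4_def)
      then have "odd (card {i. odd4 (r (insert j F) i)}) \<longleftrightarrow>
          odd (card {i. odd4 (r F i)}) \<noteq> odd4 (z j)"
        unfolding eq odd4_add odd_card_Collect_neq by simp
      then show ?thesis unfolding insert(3) euclidean_weight_word_unit[OF d] by auto
    qed
    finally show ?case .
  qed
  from this[of UNIV] show ?thesis by (simp add: r_def)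
qed

lemma odd4_entry: "d \<in> {0, 2} \<Longrightarrow> odd4 (entry d n j i) \<longleftrightarrow> j \<noteq> i"
  by (auto simp: entry_def odd4_def)

lemma odd4_word_rgt:
  assumes d: "d \<in> {0, 2}"
  shows "odd4 (word d n z $ rgt p) \<longleftrightarrow> odd (card ({j. odd4 (z j)} - {p}))"
proof -
  have "{j. odd4 (z j * entry d n j p)} = {j. odd4 (z j)} - {p}"
    by (auto simp: odd4_mult odd4_entry[OF d])
  then show ?thesis by (simp add: odd4_sum)
qed

text \<open>
Write \<open>z j = a + 2 b\<close> and \<open>N j p = 1 + 2 c\<close> with bits \<open>a\<close>, \<open>b\<close>, \<open>c\<close> for \<open>j \<noteq> p\<close>; then
\<open>z j * N j p = a + 2 (a c + b)\<close>. The term with \<open>j = p\<close> vanishes, whence the extra summand for \<open>z p = 2\<close>,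
which cancels the contribution of \<open>p\<close> to the count of all \<open>b\<close>.
\<close>

lemma word_rgt_even:
  assumes d: "d \<in> {0, 2}" and t: "tournament n" and p: "\<not> odd4 (z p)"
  shows "word d n z $ rgt p = of_nat (card {j. odd4 (z j)} +
    2 * (card {j. odd4 (z j) \<and> n j p} + card {j. z j = 2 \<or> z j = 3} + of_bool (z p = 2)))"
proof -
  have irrefl: "\<not> n p p" using t unfolding tournament_def by metis
  have "z j * entry d n j p = of_bool (odd4 (z j)) + 2 * of_bool (odd4 (z j) \<and> n j p)
      + 2 * of_bool (z j = 2 \<or> z j = 3) + (if j = p then 2 * of_bool (z p = 2) else 0)" for j
    using z4_cases[of "z j"] d p irrefl
    by (cases "j = p"; cases "n j p") (auto simp: entry_def odd4_def)
  then have "word d n z $ rgt p = (\<Sum>j\<in>UNIV. of_bool (odd4 (z j)) + 2 * of_bool (odd4 (z j) \<and> n j p)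
      + 2 * of_bool (z j = 2 \<or> z j = 3) + (if j = p then 2 * of_bool (z p = 2) else 0))"
    by simp
  also have "\<dots> = (\<Sum>j\<in>UNIV. of_bool (odd4 (z j))) + 2 * (\<Sum>j\<in>UNIV. of_bool (odd4 (z j) \<and> n j p))
      + 2 * (\<Sum>j\<in>UNIV. of_bool (z j = 2 \<or> z j = 3)) + 2 * of_bool (z p = 2)"
    by (simp only: sum.distrib sum_distrib_left sum.delta finite UNIV_I if_True)
  also have "\<dots> = of_nat (card {j. odd4 (z j)} +
      2 * (card {j. odd4 (z j) \<and> n j p} + card {j. z j = 2 \<or> z j = 3} + of_bool (z p = 2)))"
    by (simp only: sum_of_bool_eq finite Int_UNIV_left of_nat_add of_nat_mult of_nat_numeral
        of_nat_of_bool distrib_left add.assoc mult.assoc)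
  finally show ?thesis .
qed

text \<open>
Each vertex carries exactly one odd coordinate: the right one if and only if the left one is even.
\<close>

lemma euclidean_weight_word_odd:
  assumes d: "d \<in> {0, 2}" and odd: "odd (card {i. odd4 (z i)})"
  shows "euclidean_weight (word d n z) \<ge> 20"
proof -
  let ?x = "word d n z"
  have "1 \<le> wt4 (?x $ lft p) + wt4 (?x $ rgt p)" for p
  proof (cases "odd4 (z p)")
    case True
    then show ?thesis by (auto simp: odd4_def wt4_def)
  next
    case False
    then have "odd4 (?x $ rgt p)" using odd unfolding odd4_word_rgt[OF d] by simp
    then show ?thesis by (auto simp: odd4_def wt4_def)
  qed
  then have "(\<Sum>p\<in>(UNIV :: 20 set). 1) \<le> euclidean_weight ?x"
    unfolding euclidean_weight_halves by (intro sum_mono)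
  then show ?thesis by simp
qed

text \<open>
Both coordinates at a vertex of \<open>A\<close> are odd. At a vertex \<open>p\<close> outside \<open>A\<close> both are even, and by
\<open>word_rgt_even\<close> half their sum has the parity of \<open>h\<close> plus the number of arcs from \<open>A\<close> to \<open>p\<close>, where \<open>h\<close>
does not depend on \<open>p\<close>. So according to the parity of \<open>h\<close>, a coordinate equal to 2 occurs at all
vertices of the profile of \<open>A\<close>, or at all vertices outside both \<open>A\<close> and its profile.
\<close>

lemma euclidean_weight_word_even_ge:
  assumes d: "d \<in> {0, 2}" and t: "tournament n" and even: "even (card {i. odd4 (z i)})"
  defines "A \<equiv> {i. odd4 (z i)}"
  shows "2 * card A + 4 * min (card (profile n A)) (card (- A - profile n A))
    \<le> euclidean_weight (word d n z)"
proof -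
  let ?x = "word d n z"
  let ?w = "\<lambda>p. wt4 (?x $ lft p) + wt4 (?x $ rgt p)"
  obtain k where k: "card A = 2 * k" using even unfolding A_def by auto
  define h where "h = k + card {j. z j = 2 \<or> z j = 3}"
  define Q where "Q = (if even h then profile n A else - A - profile n A)"
  have fin: "finite A" and QA: "Q \<inter> A = {}"
    unfolding Q_def profile_def by auto
  have wA: "?w p \<ge> 2" if "p \<in> A" for p
  proof -
    have "odd4 (z p)" using that by (simp add: A_def)
    moreover have "card A = Suc (card (A - {p}))"
      using that by (intro card.remove) auto
    then have "odd4 (?x $ rgt p)"
      using even unfolding odd4_word_rgt[OF d] A_def by simp
    ultimately show ?thesis by (auto simp: odd4_def wt4_def)
  qed
  have wQ: "?w p \<ge> 4" if "p \<in> Q" for p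
  proof -
    have pA: "p \<notin> A" using that QA by auto
    then have z: "\<not> odd4 (z p)" by (simp add: A_def)
    have "?x $ rgt p = of_nat (2 * (h + card {j \<in> A. n j p} + of_bool (z p = 2)))"
      unfolding word_rgt_even[of d n z p, OF d t z] A_def[symmetric] k h_def
      by (simp add: A_def algebra_simps del: of_nat_add of_nat_mult)
    moreover have "odd (h + card {j \<in> A. n j p})"
      using that pA unfolding Q_def profile_def by (auto split: if_splits)
    ultimately show ?thesis
      unfolding of_nat_double by (cases "z p = 2") (auto simp: wt4_def)
  qed
  have "2 * card A + 4 * card Q = (\<Sum>p\<in>A. 2) + (\<Sum>p\<in>Q. 4)" by simp
  also have "\<dots> \<le> (\<Sum>p\<in>A. ?w p) + (\<Sum>p\<in>Q. ?w p)"
    by (intro add_mono sum_mono wA wQ)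
  also have "\<dots> = (\<Sum>p\<in>A \<union> Q. ?w p)"
    using QA by (intro sum.union_disjoint[symmetric]) auto
  also have "\<dots> \<le> euclidean_weight ?x"
    unfolding euclidean_weight_halves by (intro sum_mono2) auto
  finally have "2 * card A + 4 * card Q \<le> euclidean_weight ?x" .
  then show ?thesis unfolding Q_def by (simp split: if_splits)
qed

text \<open>
Put \<open>z = 2 t\<close>. If \<open>t\<close> has odd weight, then each vertex carries exactly one 2; otherwise the vertices
in the support of \<open>t\<close> carry two each and the others none.
\<close>

lemma euclidean_weight_word_double:
  assumes d: "d \<in> {0, 2}" and t: "tournament n" and z: "\<And>i. \<not> odd4 (z i)"
  shows "euclidean_weight (word d n z) =
    (if odd (card {i. z i = 2}) then 80 else 8 * card {i. z i = 2})"
proof -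
  let ?h = "card {i. z i = 2}"
  have z2: "z i = 0 \<or> z i = 2" for i using z[of i] z4_cases[of "z i"] by (auto simp: odd4_def)
  then have h: "{j. z j = 2 \<or> z j = 3} = {i. z i = 2}"
    using z by (auto simp: odd4_def)
  have "word d n z $ rgt p = of_nat (2 * (?h + of_bool (z p = 2)))" for p
    using word_rgt_even[of d n z p, OF d t z] z unfolding h by simp
  then have "word d n z $ rgt p = (if odd (?h + of_bool (z p = 2)) then 2 else 0)" for p
    unfolding of_nat_double .
  then have "wt4 (word d n z $ lft p) + wt4 (word d n z $ rgt p) =
      (if odd ?h then 4 else 8 * of_bool (z p = 2))" for p
    using z2[of p] by (auto simp del: word_rgt simp: wt4_def)
  then have "euclidean_weight (word d n z) = (\<Sum>p\<in>UNIV. if odd ?h then 4 else 8 * of_bool (z p = 2))"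
    unfolding euclidean_weight_halves by (simp del: word_rgt word_lft)
  also have "\<dots> = (if odd ?h then 80 else 8 * ?h)"
    by (simp add: of_bool_def sum.If_cases flip: sum_distrib_left)
  finally show ?thesis .
qed

lemma euclidean_weight_word_ge_16:
  assumes n: "n \<in> even_tournaments" and d: "d \<in> {0, 2}" and r: "robust n"
    and nz: "word d n z \<noteq> 0"
  shows "16 \<le> euclidean_weight (word d n z)"
proof -
  have t: "tournament n" using n by (simp add: even_tournaments_def)
  define A where "A = {i. odd4 (z i)}"
  let ?W = "euclidean_weight (word d n z)"
  show ?thesis
  proof (cases "odd (card A)")
    case True
    then show ?thesis using euclidean_weight_word_odd[OF d, of z n] by (simp add: A_def)
  next
    case False
    have ge: "2 * card A + 4 * min (card (profile n A)) (card (- A - profile n A)) \<le> ?W"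
      using False euclidean_weight_word_even_ge[OF d t, of z] by (simp add: A_def)
    have "?W mod 8 = 0"
      using False euclidean_weight_word_mod_8[OF n d, of z] by (simp add: A_def)
    then have "8 dvd ?W" by auto
    then obtain w where w: "?W = 8 * w" by (elim dvdE)
    have "card A = 0 \<or> card A = 2 \<or> card A = 4 \<or> 6 \<le> card A"
      using False by presburger
    then consider "A = {}" | "card A = 2" | "card A = 4" | "6 \<le> card A" by auto
    then show ?thesis
    proof cases
      case 1
      then have z: "\<not> odd4 (z i)" for i by (auto simp: A_def)
      have "\<exists>i. z i = 2"
      proof (rule ccontr)
        assume "\<nexists>i. z i = 2"
        then have "z = (\<lambda>_. 0)" using z z4_cases by (fastforce simp: odd4_def)
        then have "word d n z = 0" by (simp add: vec_eq_halves)
        then show False using nz by simp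
      qed
      then have "card {i. z i = 2} > 0" by (simp add: card_gt_0_iff)
      then show ?thesis
        using euclidean_weight_word_double[OF d t z] by (auto elim!: evenE)
    next
      case 2
      then have "\<not> unbalanced 2 n A" using r unfolding robust_def by blast
      then have "2 \<le> min (card (profile n A)) (card (- A - profile n A))"
        unfolding unbalanced_def by linarith
      then have "12 \<le> 8 * w" using ge 2 w by linarith
      then show ?thesis unfolding w by simp
    next
      case 3
      then have "\<not> unbalanced 1 n A" using r unfolding robust_def by blast
      then have "1 \<le> min (card (profile n A)) (card (- A - profile n A))"
        unfolding unbalanced_def by linarith
      then have "12 \<le> 8 * w" using ge 3 w by linarith
      then show ?thesis unfolding w by simp
    next
      case 4
      then have "12 \<le> 8 * w" using ge w by linarith
      then show ?thesis unfolding w by simp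
    qed
  qed
qed

text \<open>
The bound 16 is attained by twice the sum of two rows of the generator matrix.
\<close>

lemma extremal_code:
  assumes n: "n \<in> even_tournaments" and d: "d \<in> {0, 2}" and r: "robust n"
  shows "extremal (code d n)"
proof -
  have t: "tournament n" using n by (simp add: even_tournaments_def)
  \<comment> \<open>twice the sum of the rows with indices 0 and 1\<close>
  define z where "z = (\<lambda>i :: 20. if i = 0 \<or> i = 1 then 2 else 0 :: 4)"
  have z2: "{i. z i = 2} = {0, 1}" by (auto simp: z_def)
  have "\<not> odd4 (z i)" for i by (simp add: z_def odd4_def)
  then have w: "euclidean_weight (word d n z) = 16"
    using euclidean_weight_word_double[OF d t, of z] unfolding z2 by simp
  have "word d n z $ lft 0 \<noteq> 0 $ lft 0" unfolding word_lft by (simp add: z_def)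
  then have "word d n z \<noteq> 0" by metis
  then have "word d n z \<in> code d n - {0}" by (simp add: code_eq_range_word)
  then have "16 \<in> euclidean_weight ` (code d n - {0})" using w by (metis imageI)
  moreover have "16 \<le> y" if "y \<in> euclidean_weight ` (code d n - {0})" for y
    using that euclidean_weight_word_ge_16[OF n d r] by (auto simp: code_eq_range_word)
  ultimately have "Min (euclidean_weight ` (code d n - {0})) = 16"
    by (intro Min_eqI) auto
  then show ?thesis
    unfolding extremal_def min_euclidean_weight_def using code_self_dual[OF n d] by simp
qed

lemma type_II_code: "n \<in> even_tournaments \<Longrightarrow> type_II (code 2 n)"
  unfolding type_II_def code_eq_range_word
  using code_self_dual[of n 2] euclidean_weight_word_mod_8[of n 2]
  by (auto simp: code_eq_range_word dvd_eq_mod_eq_0)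

lemma type_I_code:
  assumes "n \<in> even_tournaments"
  shows "type_I (code 0 n)"
proof -
  have "euclidean_weight (word 0 n (unit 0 1)) mod 8 = 4"
    using euclidean_weight_word_unit[of 0 n 0 1] by (simp add: odd4_def)
  then have "\<not> 8 dvd euclidean_weight (word 0 n (unit 0 1))" by presburger
  then have "\<not> type_II (code 0 n)" unfolding type_II_def code_eq_range_word by blast
  then show ?thesis using code_self_dual[OF assms, of 0] by (simp add: type_I_def)
qed

section \<open>Counting up to equivalence\<close>

lemma odd4_code_rgt:
  assumes "d \<in> {0, 2}" "x \<in> code d n"
  shows "odd4 (x $ rgt i) \<longleftrightarrow> odd (card ({j. odd4 (x $ lft j)} - {i}))"
proof -
  obtain z where "x = word d n z" using assms(2) by (auto simp: code_eq_range_word)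
  then show ?thesis using odd4_word_rgt[OF assms(1), of n z i] by (simp del: word_rgt)
qed

text \<open>
Equivalently, the dual of the residue code has no words of weight 2; this is what makes a permutation
visible from its action on residues.
\<close>

lemma code_separates_coordinates:
  assumes d: "d \<in> {0, 2}" and ab: "a \<noteq> b"
  shows "\<exists>x\<in>code d n. odd4 (x $ a) \<noteq> odd4 (x $ b)"
proof -
  let ?x = "\<lambda>j. word d n (unit j 1)"
  have l: "odd4 (?x j $ lft i) \<longleftrightarrow> i = j" for i j
    by (simp add: unit_def odd4_def)
  have r: "odd4 (?x j $ rgt i) \<longleftrightarrow> i \<noteq> j" for i j
    using odd4_entry[OF d] by (auto simp: sum_unit)
  have mixed: "\<exists>j. odd4 (?x j $ lft i) \<noteq> odd4 (?x j $ rgt k)" for i k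
  proof (cases "i = k")
    case False
    have "card {i, k} \<noteq> card (UNIV :: 20 set)" using False by simp
    then obtain j where "j \<notin> {i, k}" by (metis UNIV_eq_I)
    then show ?thesis by (intro exI[of _ j]) (simp only: l r, blast)
  next
    case True
    then show ?thesis by (intro exI[of _ i]) (simp only: l r, simp)
  qed
  have "\<exists>j. odd4 (?x j $ a) \<noteq> odd4 (?x j $ b)"
  proof (cases a rule: halves_cases; cases b rule: halves_cases)
    fix i k assume "a = lft i" "b = lft k"
    then show ?thesis using ab by (intro exI[of _ i]) (simp only: l, blast)
  next
    fix i k assume "a = rgt i" "b = rgt k"
    then show ?thesis using ab by (intro exI[of _ i]) (simp only: r, blast)
  next
    fix i k assume "a = lft i" "b = rgt k"
    then show ?thesis using mixed[of i k] by (simp only:)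
  next
    fix i k assume *: "a = rgt i" "b = lft k"
    from mixed[of k i] obtain j where "odd4 (?x j $ lft k) \<noteq> odd4 (?x j $ rgt i)" ..
    then show ?thesis unfolding * by (intro exI[of _ j]) (rule not_sym)
  qed
  then obtain j where "odd4 (?x j $ a) \<noteq> odd4 (?x j $ b)" ..
  moreover have "?x j \<in> code d n" by (simp add: code_eq_range_word)
  ultimately show ?thesis by (rule bexI)
qed

lemma code_inj:
  assumes "tournament n" "tournament m" "d \<in> {0, 2}" "code d n = code d m"
  shows "n = m"
proof (intro ext)
  fix i j
  have "word d n (unit i 1) \<in> code d m" using assms(4) by (auto simp: code_eq_range_word)
  then have "word d n (unit i 1) $ rgt j = (\<Sum>k\<in>UNIV. word d n (unit i 1) $ lft k * entry d m k j)"
    unfolding code_def by blast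
  then have "entry d n i j = entry d m i j" by (simp add: sum_unit)
  moreover have "\<not> n i i" "\<not> m i i" using assms(1,2) unfolding tournament_def by metis+
  ultimately show "n i j = m i j" by (cases "i = j") (auto simp: entry_def split: if_splits)
qed

text \<open>
In the residue code each right coordinate is a fixed function of the left ones. An equivalence between
two codes of the family therefore forces the residue of a word at \<open>p (rgt i)\<close> to be that function of
its residues at the places \<open>p (lft j)\<close>. Since the code separates coordinates, the values of \<open>p\<close> on the
left half determine \<open>p (rgt i)\<close>.
\<close>

lemma perm_eq:
  assumes d: "d \<in> {0, 2}" and s: "\<And>i. s i \<in> {1, - 1}"
    and m: "code d m = (\<lambda>x. \<chi> i. s i * x $ p i) ` code d n"
    and m': "code d m' = (\<lambda>x. \<chi> i. s i * x $ p' i) ` code d n"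
    and pl: "p \<circ> lft = p' \<circ> lft"
  shows "p = p'"
proof -
  have s1: "odd4 (s i * a) = odd4 a" for i a
    using s[of i] by (auto simp: odd4_mult) (auto simp: odd4_def)
  have par: "odd4 (x $ p (rgt i)) \<longleftrightarrow> odd (card ({j. odd4 (x $ p (lft j))} - {i}))"
    if "x \<in> code d n" "code d m = (\<lambda>x. \<chi> i. s i * x $ p i) ` code d n" for x i p m
  proof -
    have "(\<chi> i. s i * x $ p i) \<in> code d m" using that by blast
    from odd4_code_rgt[OF d this, of i] show ?thesis by (simp add: s1)
  qed
  have l: "p (lft i) = p' (lft i)" for i using fun_cong[OF pl] by simp
  have "p (rgt i) = p' (rgt i)" for i
  proof (rule ccontr)
    assume "p (rgt i) \<noteq> p' (rgt i)"
    from code_separates_coordinates[OF d this, of n] obtain x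
      where x: "x \<in> code d n" "odd4 (x $ p (rgt i)) \<noteq> odd4 (x $ p' (rgt i))" by blast
    show False using x(2) par[OF x(1) m, of i] par[OF x(1) m', of i] by (simp add: l)
  qed
  then show ?thesis using l by (intro ext) (metis halves_cases)
qed

text \<open>
By \<open>perm_eq\<close> an equivalent code of the family is determined by 40 signs and the images of 20
coordinates.
\<close>

lemma card_equivalent_le:
  assumes d: "d \<in> {0, 2}"
  shows "card {m \<in> even_tournaments. code_equivalent (code d n) (code d m)} \<le> 2 ^ 40 * 40 ^ 20"
proof -
  let ?M = "{m \<in> even_tournaments. code_equivalent (code d n) (code d m)}"
  let ?S = "UNIV \<rightarrow>\<^sub>E {1, - 1 :: 4} :: (40 \<Rightarrow> 4) set"
  have "\<forall>m\<in>?M. \<exists>q :: (40 \<Rightarrow> 40) \<times> (40 \<Rightarrow> 4). (\<forall>i. snd q i \<in> {1, - 1}) \<and>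
      code d m = (\<lambda>x. \<chi> i. snd q i * x $ fst q i) ` code d n"
    unfolding code_equivalent_def by auto
  then obtain q :: "_ \<Rightarrow> (40 \<Rightarrow> 40) \<times> (40 \<Rightarrow> 4)" where
    q: "\<forall>m\<in>?M. (\<forall>i. snd (q m) i \<in> {1, - 1}) \<and>
      code d m = (\<lambda>x. \<chi> i. snd (q m) i * x $ fst (q m) i) ` code d n"
    by (rule bchoice[THEN exE])
  let ?f = "\<lambda>m. (snd (q m), fst (q m) \<circ> lft)"
  have "inj_on ?f ?M"
  proof (rule inj_onI)
    fix m m' assume h: "m \<in> ?M" "m' \<in> ?M" "?f m = ?f m'"
    have sgn: "snd (q m) = snd (q m')" using h(3) by simp
    have e: "code d m = (\<lambda>x. \<chi> i. snd (q m) i * x $ fst (q m) i) ` code d n"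
      using q h(1) by blast
    have e': "code d m' = (\<lambda>x. \<chi> i. snd (q m) i * x $ fst (q m') i) ` code d n"
      unfolding sgn using q h(2) by blast
    have "fst (q m) = fst (q m')"
      by (rule perm_eq[OF d _ e e']) (use q h in auto)
    then have "code d m = code d m'" unfolding e e' by simp
    then show "m = m'" using h(1,2) d by (intro code_inj) (auto simp: even_tournaments_def)
  qed
  moreover have "?f ` ?M \<subseteq> ?S \<times> UNIV"
    using q by (auto simp: PiE_def Pi_def)
  moreover have fin: "finite (?S \<times> (UNIV :: (20 \<Rightarrow> 40) set))"
    by (intro finite_cartesian_product finite_PiE) auto
  ultimately have "card ?M \<le> card (?S \<times> (UNIV :: (20 \<Rightarrow> 40) set))"
    by (intro card_inj_on_le)
  also have "\<dots> = card ?S * card (UNIV :: (20 \<Rightarrow> 40) set)"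
    by (rule card_cartesian_product)
  also have "card ?S = card {1, - 1 :: 4} ^ CARD(40)" by (rule card_funcsetE) simp
  also have "card {1, - 1 :: 4} = 2" by simp
  also have "CARD(40) = 40" by simp
  also have "card (UNIV :: (20 \<Rightarrow> 40) set) = 40 ^ 20" by (simp add: card_fun)
  finally show ?thesis .
qed

lemma code_equivalent_refl: "code_equivalent C C"
  unfolding code_equivalent_def
  by (rule exI[of _ "\<lambda>i. i"], rule exI[of _ "\<lambda>_. 1"]) (auto simp: bij_id[unfolded id_def])

lemma code_equivalent_sym:
  assumes "code_equivalent C D"
  shows "code_equivalent D C"
proof -
  from assms obtain p s where p: "bij p" and s: "\<And>i. s i \<in> {1, - 1 :: 4}"
    and D: "D = (\<lambda>x. \<chi> i. s i * x $ p i) ` C"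
    unfolding code_equivalent_def by blast
  have ss: "s i * s i = 1" for i using s[of i] by auto
  have "(\<lambda>x. \<chi> i. s (inv p i) * x $ inv p i) ` D = (\<lambda>x. x) ` C"
    unfolding D image_image
    by (intro image_cong) (auto simp: vec_eq_iff ss surj_f_inv_f[OF bij_is_surj[OF p]] simp flip: mult.assoc)
  then show ?thesis
    unfolding code_equivalent_def
    by (intro exI[of _ "inv p"] exI[of _ "\<lambda>i. s (inv p i)"]) (use s bij_imp_bij_inv[OF p] in auto)
qed

text \<open>
A maximal set of pairwise unrelated elements works: every element of \<open>F\<close> is related to a member of it.
\<close>

lemma pairwise_unrelated_subset:
  assumes F: "finite F" and refl: "\<And>x. R x x" and sym: "\<And>x y. R x y \<Longrightarrow> R y x"
    and K: "\<And>x. x \<in> F \<Longrightarrow> card {y \<in> F. R x y} \<le> K"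
  obtains S where "S \<subseteq> F" "pairwise (\<lambda>x y. \<not> R x y) S" "card F \<le> card S * K"
proof -
  let ?P = "{S. S \<subseteq> F \<and> pairwise (\<lambda>x y. \<not> R x y) S}"
  have "finite ?P" "?P \<noteq> {}" using F by (auto intro: exI[of _ "{}"])
  from finite_has_maximal[OF this]
  obtain S where S: "S \<in> ?P" and max: "\<forall>S'\<in>?P. S \<subseteq> S' \<longrightarrow> S = S'"
    by (rule bexE)
  have fin: "finite S" using S F finite_subset by auto
  have "F \<subseteq> (\<Union>x\<in>S. {y \<in> F. R x y})"
  proof
    fix y assume y: "y \<in> F"
    have "\<exists>x\<in>S. R x y"
    proof (rule ccontr)
      assume no: "\<not> (\<exists>x\<in>S. R x y)"
      then have "insert y S \<in> ?P"
        using S y sym by (auto simp: pairwise_insert)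
      then have "S = insert y S" using max by blast
      then have "y \<in> S" by blast
      then show False using no refl by blast
    qed
    then show "y \<in> (\<Union>x\<in>S. {y \<in> F. R x y})" using y by auto
  qed
  then have "card F \<le> card (\<Union>x\<in>S. {y \<in> F. R x y})"
    using F fin by (intro card_mono) auto
  also have "\<dots> \<le> (\<Sum>x\<in>S. card {y \<in> F. R x y})"
    by (rule card_UN_le[OF fin])
  also have "\<dots> \<le> (\<Sum>x\<in>S. K)"
    using S K by (intro sum_mono) auto
  finally have "card F \<le> card S * K" by simp
  then show ?thesis using that S by auto
qed

lemma many_inequivalent_codes:
  assumes d: "d \<in> {0, 2}"
  obtains S where "S \<subseteq> code d ` {n \<in> even_tournaments. robust n}" "finite S"
    "16470 \<le> card S" "pairwise (\<lambda>C D. \<not> code_equivalent C D) S"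
proof -
  let ?G = "{n \<in> even_tournaments :: (20 \<Rightarrow> 20 \<Rightarrow> bool) set. robust n}"
  let ?F = "code d ` ?G"
  have inj: "inj_on (code d) even_tournaments"
    using code_inj[OF _ _ d] by (auto simp: inj_on_def even_tournaments_def)
  have K: "card {D \<in> ?F. code_equivalent C D} \<le> 2 ^ 40 * 40 ^ 20" if CF: "C \<in> ?F" for C
  proof -
    obtain n where C: "C = code d n" using CF by blast
    have "card {D \<in> ?F. code_equivalent C D}
        \<le> card (code d ` {m \<in> even_tournaments. code_equivalent (code d n) (code d m)})"
      unfolding C by (intro card_mono) auto
    also have "\<dots> \<le> card {m \<in> even_tournaments. code_equivalent (code d n) (code d m)}"
      by (intro card_image_le) auto
    finally show ?thesis using card_equivalent_le[OF d, of n] by linarith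
  qed
  have "finite ?F" by simp
  from pairwise_unrelated_subset[OF this code_equivalent_refl code_equivalent_sym K]
  obtain S where S: "S \<subseteq> ?F" "pairwise (\<lambda>C D. \<not> code_equivalent C D) S"
      "card ?F \<le> card S * (2 ^ 40 * 40 ^ 20)"
    by blast
  have "card ?F = card ?G"
    by (intro card_image inj_on_subset[OF inj]) auto
  then have "2 ^ 168 \<le> card S * (2 ^ 40 * 40 ^ 20)"
    using card_even_tournaments card_robust S(3) by simp
  then have "16470 \<le> card S" by simp
  then show ?thesis by (rule that[OF S(1) finite_subset[OF S(1) \<open>finite ?F\<close>] _ S(2)])
qed

section \<open>Extremal codes of both types\<close>

theorem proposition5p2:
  "(\<exists>S :: (4 ^ 40) set set.
      finite S \<and> card S \<ge> 16470 \<and>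
      (\<forall>C\<in>S. type_II C \<and> extremal C) \<and>
      pairwise (\<lambda>C D. \<not> code_equivalent C D) S) \<and>
   (\<exists>S :: (4 ^ 40) set set.
      finite S \<and> card S \<ge> 16470 \<and>
      (\<forall>C\<in>S. type_I C \<and> extremal C) \<and>
      pairwise (\<lambda>C D. \<not> code_equivalent C D) S)"
proof (intro conjI)
  obtain S where S: "S \<subseteq> code 2 ` {n \<in> even_tournaments. robust n}" "finite S"
      "16470 \<le> card S" "pairwise (\<lambda>C D. \<not> code_equivalent C D) S"
    by (rule many_inequivalent_codes[of 2]) auto
  have "\<forall>C\<in>S. type_II C \<and> extremal C"
    using S(1) type_II_code extremal_code[of _ 2] by auto
  then show "\<exists>S :: (4 ^ 40) set set. finite S \<and> card S \<ge> 16470 \<and>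
      (\<forall>C\<in>S. type_II C \<and> extremal C) \<and> pairwise (\<lambda>C D. \<not> code_equivalent C D) S"
    using S(2-4) by (intro exI[of _ S] conjI)
next
  obtain S where S: "S \<subseteq> code 0 ` {n \<in> even_tournaments. robust n}" "finite S"
      "16470 \<le> card S" "pairwise (\<lambda>C D. \<not> code_equivalent C D) S"
    by (rule many_inequivalent_codes[of 0]) auto
  have "\<forall>C\<in>S. type_I C \<and> extremal C"
    using S(1) type_I_code extremal_code[of _ 0] by auto
  then show "\<exists>S :: (4 ^ 40) set set. finite S \<and> card S \<ge> 16470 \<and>
      (\<forall>C\<in>S. type_I C \<and> extremal C) \<and> pairwise (\<lambda>C D. \<not> code_equivalent C D) S"
    using S(2-4) by (intro exI[of _ S] conjI)
qed

end
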